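(* Let $\mathbf{G}(V,E)$ be a connected undirected graph of diameter $D$, and for each node $i\in V$ let $\mathbf{C}_i$ be a nonzero real matrix and let $\mu_i,\beta_i>0$. Let $\mathbf{C}$ be the block diagonal matrix with diagonal blocks $\mathbf{C}_i$, $i\in V$, and put $\mu=\min_{i\in V}\mu_i$ and $\beta=\max_{i\in V}\beta_i$. Consider the distributed procedure in which node $i$ initialises $\sigma^{(0)}_{\max,i}=\sigma_{\max}(\mathbf{C}_i)$, $\sigma^{(0)}_{\min\neq0,i}=\sigma_{\min\neq0}(\mathbf{C}_i)$, $\mu_i^{(0)}=\mu_i$, $\beta_i^{(0)}=\beta_i$ and, for $k=0,\dots,D-1$, after exchanging values with its neighbours $\mathcal{N}(i)$, computes $$\sigma^{(k+1)}_{\max,i}=\max_{j\in\mathcal{N}(i)\cup\{i\}}\sigma^{(k)}_{\max,j},\quad \sigma^{(k+1)}_{\min\neq0,i}=\min_{j\in\mathcal{N}(i)\cup\{i\}}\sigma^{(k)}_{\min\neq0,j},\quad \mu_i^{(k+1)}=\min_{j\in\mathcal{N}(i)\cup\{i\}}\mu_j^{(k)},\quad \beta_i^{(k+1)}=\max_{j\in\mathcal{N}(i)\cup\{i\}}\beta_j^{(k)}.$$ Then after these $D$ rounds of exchange every node $i\in V$ obtains the step size $$\rho_i^*=\frac{\sqrt{\beta_i^{(D)}\mu_i^{(D)}}}{\sigma^{(D)}_{\max,i}\,\sigma^{(D)}_{\min\neq0,i}}=\frac{\sqrt{\beta\mu}}{\sigma_{\max}(\mathbf{C})\,\sigma_{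\min\neq0}(\mathbf{C})}.$$
   Context: $\mathcal{N}(i)=\{j\in V:(i,j)\in E\}$. For a nonzero matrix $\mathbf{M}$, $\sigma_{\max}(\mathbf{M})$ and $\sigma_{\min\neq0}(\mathbf{M})$ denote its largest and its smallest nonzero singular value. The diameter $D$ is the largest graph distance between two nodes. (In the application, $\mu_i$ and $\beta_i$ are the strong convexity and smoothness constants of a local objective function at node $i$, and $\mathbf{C}_i$ stacks the constraint matrices of the edges at node $i$.) *)

theory Defs
  imports
    "Graph_Theory.Shortest_Path"
    "Graph_Theory.Digraph_Component"
    "Jordan_Normal_Form.Char_Poly"
begin

definition neighbours :: "'a pair_pre_digraph \<Rightarrow> 'a \<Rightarrow> 'a set" where
  "neighbours G i = {j \<in> pverts G. (i, j) \<in> parcs G}"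

text \<open>The graph distance is the library's shortest-path cost with every arc of cost 1; it is
  \<open>\<infinity>\<close> between nodes that are not joined by a walk.\<close>

definition graph_dist :: "'a pair_pre_digraph \<Rightarrow> 'a \<Rightarrow> 'a \<Rightarrow> ereal" where
  "graph_dist G u v = wf_digraph.\<mu> (with_proj G) (\<lambda>_. 1) u v"

definition graph_diameter :: "'a pair_pre_digraph \<Rightarrow> ereal" where
  "graph_diameter G = Max {graph_dist G u v | u v. u \<in> pverts G \<and> v \<in> pverts G}"

text \<open>For an \<open>m \<times> n\<close> matrix with \<open>m < n\<close> this set contains 0 even if the convention that counts
  only \<open>min m n\<close> singular values would not list it; neither the largest nor the smallest nonzero
  singular value of a nonzero matrix depends on this.\<close>

definition singular_values :: "real mat \<Rightarrow> real set" where
  "singular_values A = {sqrt e | e. eigenvalue (transpose_mat A * A) e}"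

definition sigma_max :: "real mat \<Rightarrow> real" where
  "sigma_max A = Max (singular_values A)"

definition sigma_min_nz :: "real mat \<Rightarrow> real" where
  "sigma_min_nz A = Min (singular_values A - {0})"

end

theory Submission
  imports Defs "Jordan_Normal_Form.Schur_Decomposition"
begin

text \<open>After \<open>k\<close> rounds the value at node \<open>i\<close> is the extremum of the initial values over the nodes
  within distance \<open>k\<close>, so after \<open>D\<close> rounds it is the extremum over all nodes. It remains to match
  these extrema with those of the block diagonal matrix \<open>C\<close>: the Gram matrix of \<open>C\<close> is the block
  diagonal of the Gram matrices, so its characteristic polynomial is the product of theirs and
  the singular values of \<open>C\<close> are those of the blocks together. Each nonzero block has a nonzero
  singular value, because the trace of its Gram matrix is positive while the eigenvalues of a
  symmetric matrix are real and sum up to the trace.\<close>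

section \<open>Spreading of extrema along walks\<close>

text \<open>The distance is an infimum of walk lengths and is bounded by the finite diameter, so
  some walk comes within less than 1 of that bound; integrality of lengths does the rest.\<close>

lemma walk_of_length_le_diameter:
  assumes "pair_fin_digraph G" and "ereal (real D) = graph_diameter G"
    and "u \<in> pverts G" and "v \<in> pverts G"
  obtains p where "pre_digraph.awalk (with_proj G) u p v" and "length p \<le> D"
proof -
  interpret pair_fin_digraph G by fact
  have "{graph_dist G u v | u v. u \<in> pverts G \<and> v \<in> pverts G}
      = (\<lambda>(u, v). graph_dist G u v) ` (pverts G \<times> pverts G)"
    by auto
  then have "finite {graph_dist G u v | u v. u \<in> pverts G \<and> v \<in> pverts G}"
    by (simp add: pair_finite_verts)
  then have "graph_dist G u v \<le> graph_diameter G"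
    unfolding graph_diameter_def using assms(3,4) by (intro Max_ge) auto
  \<comment> \<open>An infimum strictly below a bound has a member below that bound; a length below
    \<open>D + 1\<close> is at most \<open>D\<close>.\<close>
  also have "\<dots> < ereal (real D + 1)"
    using assms(2) by (metis less_add_one less_ereal.simps(1))
  finally obtain p where p: "awalk u p v" "awalk_cost (\<lambda>_. 1) p < real D + 1"
    unfolding graph_dist_def \<mu>_def by (auto simp: INF_less_iff)
  moreover have "awalk_cost (\<lambda>_. 1) p = real (length p)"
    by (induction p) auto
  ultimately show thesis
    by (intro that[of p]) auto
qed

text \<open>Induction on the rounds: the last round carries information over the first arc of the
  walk, and the earlier rounds carry it over the remaining arcs.\<close>

lemma Max_spreads_along_walk:
  fixes f :: "nat \<Rightarrow> 'a \<Rightarrow> 'b::linorder"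
  assumes "pair_fin_digraph G"
    and step: "\<And>k i. k < D \<Longrightarrow> i \<in> pverts G \<Longrightarrow> f (k + 1) i = Max (f k ` (neighbours G i \<union> {i}))"
    and "pre_digraph.awalk (with_proj G) i p j" and "length p \<le> k" and "k \<le> D"
  shows "f 0 j \<le> f k i"
proof -
  interpret pair_fin_digraph G by fact
  show ?thesis
    using assms(3-)
  proof (induction k arbitrary: i p)
    case 0
    then show ?case by (simp add: awalk_Nil_iff)
  next
    case (Suc k)
    have i: "i \<in> pverts G"
      using Suc.prems(1) by auto
    have fin: "finite (neighbours G i \<union> {i})"
      using pair_finite_verts by (auto simp: neighbours_def)
    \<comment> \<open>An empty walk has no first arc; then the value stays at \<open>i\<close>,
      which takes part in its own update. This is how walks shorter than the number of rounds are
      covered.\<close>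
    obtain i' q where i': "i' \<in> neighbours G i \<union> {i}" and "awalk i' q j" "length q \<le> k"
    proof (cases p)
      case Nil
      with Suc.prems show thesis by (intro that[of i p]) auto
    next
      case (Cons e q)
      with Suc.prems show thesis
        by (intro that[of "snd e" q])
          (auto simp: awalk_Cons_iff neighbours_def intro: arc_snd_in_verts)
    qed
    then have "f 0 j \<le> f k i'"
      using Suc.IH Suc.prems by simp
    also have "\<dots> \<le> f (Suc k) i"
      using step[of k i] Suc.prems i i' fin by (auto intro!: Max_ge)
    finally show ?case .
  qed
qed

text \<open>Rounds never create new values, so \<open>f D i\<close> is one of the initial ones; and
  each initial value reaches \<open>i\<close> along a walk of length at most \<open>D\<close>, so
  \<open>f D i\<close> dominates them all.\<close>

lemma Max_consensus:
  fixes f :: "nat \<Rightarrow> 'a \<Rightarrow> 'b::linorder"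
  assumes "pair_fin_digraph G" and "ereal (real D) = graph_diameter G"
    and step: "\<And>k i. k < D \<Longrightarrow> i \<in> pverts G \<Longrightarrow> f (k + 1) i = Max (f k ` (neighbours G i \<union> {i}))"
    and i: "i \<in> pverts G"
  shows "f D i = Max (f 0 ` pverts G)"
proof -
  interpret pair_fin_digraph G by fact
  have "f k i \<in> f 0 ` pverts G" if "k \<le> D" "i \<in> pverts G" for k i
    using that
  proof (induction k arbitrary: i)
    case (Suc k)
    have "finite (neighbours G i \<union> {i})"
      using pair_finite_verts by (auto simp: neighbours_def)
    then have "f (Suc k) i \<in> f k ` (neighbours G i \<union> {i})"
      using step[of k i] Suc.prems Max_in[of "f k ` (neighbours G i \<union> {i})"] by auto
    then obtain i' where "f (Suc k) i = f k i'" "i' \<in> pverts G"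
      using Suc.prems by (auto simp: neighbours_def)
    then show ?case
      using Suc by auto
  qed auto
  moreover have "f 0 j \<le> f D i" if j: "j \<in> pverts G" for j
  proof -
    obtain p where "awalk i p j" "length p \<le> D"
      using walk_of_length_le_diameter[OF assms(1,2) i j] .
    then show ?thesis
      by (intro Max_spreads_along_walk[where f = f and D = D, OF assms(1) step]) auto
  qed
  ultimately show ?thesis
    using i pair_finite_verts by (intro Max_eqI[symmetric]) auto
qed

text \<open>Negation exchanges minima and maxima, hence the ordered group as value type.\<close>

lemma Min_consensus:
  fixes f :: "nat \<Rightarrow> 'a \<Rightarrow> 'b::linordered_ab_group_add"
  assumes "pair_fin_digraph G" and "ereal (real D) = graph_diameter G"
    and step: "\<And>k i. k < D \<Longrightarrow> i \<in> pverts G \<Longrightarrow> f (k + 1) i = Min (f k ` (neighbours G i \<union> {i}))"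
    and i: "i \<in> pverts G"
  shows "f D i = Min (f 0 ` pverts G)"
proof -
  interpret pair_fin_digraph G by fact
  have fin: "finite (neighbours G i \<union> {i})" for i
    using pair_finite_verts by (auto simp: neighbours_def)
  have neg: "- Min (g ` S) = Max ((\<lambda>x. - g x) ` S)" if "finite S" "S \<noteq> {}" for g :: "'a \<Rightarrow> 'b" and S
    using minus_Min_eq_Max[of "g ` S"] that by (simp add: image_image)
  \<comment> \<open>\<open>Un_insert_right\<close> is disabled so that the index set keeps the form
    in which \<open>fin\<close> states its finiteness.\<close>
  have "- f D i = Max ((\<lambda>j. - f 0 j) ` pverts G)"
    by (rule Max_consensus[where f = "\<lambda>k j. - f k j", OF assms(1,2) _ i])
      (subst step, simp_all add: neg[OF fin] del: Un_insert_right)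
  also have "\<dots> = - Min (f 0 ` pverts G)"
    using i pair_finite_verts by (subst neg) auto
  finally show ?thesis by simp
qed

section \<open>Singular values of block diagonal matrices\<close>

text \<open>The characteristic matrix is again block diagonal, and its determinant factors.\<close>

lemma char_poly_block_diag:
  fixes A B :: "'a::idom mat"
  assumes A: "A \<in> carrier_mat n n" and B: "B \<in> carrier_mat m m"
  shows "char_poly (four_block_mat A (0\<^sub>m n m) (0\<^sub>m m n) B) = char_poly A * char_poly B"
proof -
  have "char_poly_matrix (four_block_mat A (0\<^sub>m n m) (0\<^sub>m m n) B)
      = four_block_mat (char_poly_matrix A) (0\<^sub>m n m) (0\<^sub>m m n) (char_poly_matrix B)"
    using A B by (intro eq_matI) (auto simp: char_poly_matrix_def)
  then show ?thesis
    unfolding char_poly_def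
    using A B by (simp add: det_four_block_mat_lower_left_zero[of _ n _ m])
qed

lemma gram_block_diag:
  fixes A B :: "'a::comm_semiring_0 mat"
  assumes A: "A \<in> carrier_mat r n" and B: "B \<in> carrier_mat s m"
  defines "M \<equiv> four_block_mat A (0\<^sub>m r m) (0\<^sub>m s n) B"
  shows "transpose_mat M * M
    = four_block_mat (transpose_mat A * A) (0\<^sub>m n m) (0\<^sub>m m n) (transpose_mat B * B)"
proof -
  have "transpose_mat M
      = four_block_mat (transpose_mat A) (0\<^sub>m n s) (0\<^sub>m m r) (transpose_mat B)"
    unfolding M_def using A B by (subst transpose_four_block_mat[of _ r n _ m _ s]) auto
  then show ?thesis
    unfolding M_def using A B
    by (subst \<open>transpose_mat M = _\<close>[unfolded M_def],
        subst mult_four_block_mat[of _ n r _ s _ m _ _ n _ m]) auto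
qed

text \<open>Eigenvalues are the roots of the characteristic polynomial, and a product vanishes
  exactly where one of its factors does.\<close>

lemma singular_values_block_diag:
  assumes A: "A \<in> carrier_mat r n" and B: "B \<in> carrier_mat s m"
  shows "singular_values (four_block_mat A (0\<^sub>m r m) (0\<^sub>m s n) B)
    = singular_values A \<union> singular_values B"
proof -
  let ?g = "\<lambda>M :: real mat. transpose_mat M * M"
  have g: "?g A \<in> carrier_mat n n" "?g B \<in> carrier_mat m m"
    using A B by auto
  then have "eigenvalue (four_block_mat (?g A) (0\<^sub>m n m) (0\<^sub>m m n) (?g B)) e
      \<longleftrightarrow> eigenvalue (?g A) e \<or> eigenvalue (?g B) e" for e
    by (subst (1 2 3) eigenvalue_root_char_poly) (auto simp: char_poly_block_diag)
  then show ?thesis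
    unfolding singular_values_def gram_block_diag[OF A B] by auto
qed

lemma singular_values_diag_block_mat:
  "singular_values (diag_block_mat As) = (\<Union>A\<in>set As. singular_values A)"
proof (induction As)
  case Nil
  \<comment> \<open>The empty block list yields the 0 by 0 matrix, whose space contains no nonzero
    vector.\<close>
  have "\<not> eigenvalue (transpose_mat (0\<^sub>m 0 0) * 0\<^sub>m 0 0 :: real mat) e" for e
    using eigenvalue_imp_nonzero_dim[of "transpose_mat (0\<^sub>m 0 0) * 0\<^sub>m 0 0 :: real mat" 0 e] by auto
  then show ?case by (auto simp: singular_values_def)
next
  case (Cons A As)
  then show ?case
    by (simp add: Let_def singular_values_block_diag[of A "dim_row A" "dim_col A"
          "diag_block_mat As" "dim_row (diag_block_mat As)" "dim_col (diag_block_mat As)"])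
qed

lemma finite_eigenvalues:
  fixes A :: "'a::field mat"
  assumes "A \<in> carrier_mat n n"
  shows "finite {e. eigenvalue A e}"
proof -
  have "char_poly A \<noteq> 0"
    using degree_monic_char_poly[OF assms] by auto
  then show ?thesis
    by (simp add: eigenvalue_root_char_poly[OF assms] poly_roots_finite)
qed

lemma finite_singular_values: "finite (singular_values A)"
proof -
  have "singular_values A = sqrt ` {e. eigenvalue (transpose_mat A * A) e}"
    by (auto simp: singular_values_def)
  moreover have "transpose_mat A * A \<in> carrier_mat (dim_col A) (dim_col A)"
    by auto
  ultimately show ?thesis
    using finite_eigenvalues[of "transpose_mat A * A" "dim_col A"] by simp
qed

section \<open>Existence of a nonzero singular value\<close>

definition mat_trace :: "'a::comm_monoid_add mat \<Rightarrow> 'a" where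
  "mat_trace A = (\<Sum>i<dim_row A. A $$ (i, i))"

lemma mat_trace_mult_commute:
  fixes A B :: "'a::comm_semiring_0 mat"
  assumes "A \<in> carrier_mat n m" and "B \<in> carrier_mat m n"
  shows "mat_trace (A * B) = mat_trace (B * A)"
proof -
  have "mat_trace (A * B) = (\<Sum>i<n. \<Sum>j<m. A $$ (i, j) * B $$ (j, i))"
    using assms by (auto simp: mat_trace_def scalar_prod_def atLeast0LessThan intro!: sum.cong)
  also have "\<dots> = (\<Sum>j<m. \<Sum>i<n. B $$ (j, i) * A $$ (i, j))"
    by (subst sum.swap) (simp add: mult.commute)
  also have "\<dots> = mat_trace (B * A)"
    using assms by (auto simp: mat_trace_def scalar_prod_def atLeast0LessThan intro!: sum.cong)
  finally show ?thesis .
qed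

text \<open>Cyclicity of the trace brings \<open>Q\<close> next to \<open>P\<close>, where the two
  cancel.\<close>

lemma mat_trace_similar:
  fixes A B :: "'a::comm_semiring_1 mat"
  assumes "similar_mat A B"
  shows "mat_trace A = mat_trace B"
proof -
  obtain n P Q where carr: "{A, B, P, Q} \<subseteq> carrier_mat n n"
    and QP: "Q * P = 1\<^sub>m n" and A: "A = P * B * Q"
    using similar_matD[OF assms] by blast
  have "mat_trace A = mat_trace (Q * (P * B))"
    unfolding A using carr by (intro mat_trace_mult_commute[of _ n n]) auto
  also have "Q * (P * B) = B"
    using carr QP by (auto simp flip: assoc_mult_mat[of Q n n P n B n])
  finally show ?thesis .
qed

text \<open>Over the complex numbers the characteristic polynomial splits, so a Schur form has all
  its roots on the diagonal. The trace is their sum, and a nonzero sum has a nonzero term.\<close>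

lemma nonzero_eigenvalue_if_mat_trace_nonzero:
  fixes A :: "complex mat"
  assumes A: "A \<in> carrier_mat n n" and "mat_trace A \<noteq> 0"
  obtains e where "eigenvalue A e" and "e \<noteq> 0"
proof -
  obtain es where es: "char_poly A = (\<Prod>e\<leftarrow>es. [:- e, 1:])"
    using char_poly_factorized[OF A] by blast
  obtain B P Q where "schur_decomposition A es = (B, P, Q)"
    by (cases "schur_decomposition A es")
  from schur_decomposition[OF A es this]
  have sim: "similar_mat A B" and diag: "diag_mat B = es"
    by (auto simp: similar_mat_def)
  have "mat_trace B = sum_list es"
    by (simp add: mat_trace_def diag[symmetric] diag_mat_def interv_sum_list_conv_sum_set_nat
        atLeast0LessThan)
  then have "sum_list es \<noteq> 0"
    using assms(2) mat_trace_similar[OF sim] by simp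
  then obtain e where "e \<in> set es" "e \<noteq> 0"
    by (metis sum_list_neutral)
  moreover from this have "eigenvalue A e"
    unfolding eigenvalue_root_char_poly[OF A] es by (induction es) auto
  ultimately show thesis
    by (intro that)
qed

text \<open>The Hermitian argument: symmetry moves \<open>?A\<close> across the scalar product of
  \<open>v\<close> and \<open>conjugate v\<close>, giving the factor \<open>cnj e\<close> on one
  side and \<open>e\<close> on the other; that product is nonzero because \<open>v\<close>
  is.\<close>

lemma eigenvalue_real_symmetric_real:
  fixes A :: "real mat"
  assumes A: "A \<in> carrier_mat n n" and sym: "transpose_mat A = A"
    and "eigenvalue (map_mat complex_of_real A) e"
  shows "e \<in> \<real>"
proof -
  let ?A = "map_mat complex_of_real A"
  have cA: "?A \<in> carrier_mat n n" and symA: "transpose_mat ?A = ?A"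
    using A sym by (auto simp: map_mat_transpose)
  obtain v where v: "v \<in> carrier_vec n" "v \<noteq> 0\<^sub>v n" and ev: "?A *\<^sub>v v = e \<cdot>\<^sub>v v"
    using assms(3) A by (auto simp: eigenvalue_def eigenvector_def)
  have "conjugate (?A *\<^sub>v v) = ?A *\<^sub>v conjugate v"
  proof (rule eq_vecI)
    fix i assume "i < dim_vec (?A *\<^sub>v conjugate v)"
    then show "conjugate (?A *\<^sub>v v) $ i = (?A *\<^sub>v conjugate v) $ i"
      using A v by (auto simp: scalar_prod_def)
  qed (use A in auto)
  then have "cnj e * (v \<bullet> conjugate v) = v \<bullet> (?A *\<^sub>v conjugate v)"
    using v by (simp flip: \<open>conjugate (?A *\<^sub>v v) = ?A *\<^sub>v conjugate v\<close> add: ev conjugate_smult_vec)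
  also have "\<dots> = (?A *\<^sub>v v) \<bullet> conjugate v"
    using transpose_vec_mult_scalar[OF cA, of "conjugate v" v] v symA by simp
  also have "\<dots> = e * (v \<bullet> conjugate v)"
    using v by (simp add: ev)
  finally have "cnj e = e"
    using v by simp
  then show ?thesis
    by (simp add: Reals_cnj_iff)
qed

text \<open>A nonzero eigenvalue is found for the complexified matrix. It is real by symmetry, and
  it is a root of the real characteristic polynomial, since complexification only embeds the
  coefficients.\<close>

lemma real_symmetric_nonzero_eigenvalue:
  fixes A :: "real mat"
  assumes A: "A \<in> carrier_mat n n" and sym: "transpose_mat A = A" and "mat_trace A \<noteq> 0"
  obtains e where "eigenvalue A e" and "e \<noteq> 0"
proof -
  let ?A = "map_mat complex_of_real A"
  have cA: "?A \<in> carrier_mat n n"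
    using A by simp
  have "mat_trace ?A = complex_of_real (mat_trace A)"
    using A by (simp add: mat_trace_def)
  then obtain z where z: "eigenvalue ?A z" "z \<noteq> 0"
    using nonzero_eigenvalue_if_mat_trace_nonzero[OF cA] assms(3) by auto
  then obtain e where e: "z = complex_of_real e"
    using eigenvalue_real_symmetric_real[OF A sym] by (auto elim: Reals_cases)
  have "poly (map_poly complex_of_real (char_poly A)) (complex_of_real e) = 0"
    using z(1) by (simp add: e eigenvalue_root_char_poly[OF cA] of_real_hom.char_poly_hom[OF A])
  then have "eigenvalue A e"
    by (simp add: eigenvalue_root_char_poly[OF A])
  then show thesis
    using that z(2) e by auto
qed

text \<open>This trace is the sum of the squares of all entries, the squared Frobenius norm.\<close>

lemma mat_trace_gram_pos:
  fixes A :: "real mat"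
  assumes "A \<noteq> 0\<^sub>m (dim_row A) (dim_col A)"
  shows "mat_trace (transpose_mat A * A) > 0"
proof -
  have tr: "mat_trace (transpose_mat A * A) = (\<Sum>j<dim_col A. \<Sum>i<dim_row A. (A $$ (i, j))\<^sup>2)"
    by (auto simp: mat_trace_def scalar_prod_def atLeast0LessThan power2_eq_square intro!: sum.cong)
  obtain i j where ij: "i < dim_row A" "j < dim_col A" "A $$ (i, j) \<noteq> 0"
    using assms by (metis eq_matI index_zero_mat)
  have "(\<Sum>i<dim_row A. (A $$ (i, j))\<^sup>2) > 0"
    using ij by (auto intro!: sum_pos2[where i = i])
  then show ?thesis
    unfolding tr using ij by (subst sum_pos2[where i = j]) (auto intro: sum_nonneg)
qed

lemma nonzero_singular_value_exists:
  assumes "A \<noteq> 0\<^sub>m (dim_row A) (dim_col A)"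
  shows "singular_values A - {0} \<noteq> {}"
proof -
  have "transpose_mat (transpose_mat A * A) = transpose_mat A * A"
    by (subst transpose_mult[of _ "dim_col A" "dim_row A" _ "dim_col A"]) auto
  moreover have "transpose_mat A * A \<in> carrier_mat (dim_col A) (dim_col A)"
    by auto
  moreover have "mat_trace (transpose_mat A * A) \<noteq> 0"
    using mat_trace_gram_pos[OF assms] by simp
  ultimately obtain e where "eigenvalue (transpose_mat A * A) e" "e \<noteq> 0"
    using real_symmetric_nonzero_eigenvalue by blast
  \<comment> \<open>The function \<open>sqrt\<close> is odd on the reals and vanishes only at 0, so
    \<open>e \<noteq> 0\<close> carries over to the root.\<close>
  then have "sqrt e \<in> singular_values A - {0}"
    by (auto simp: singular_values_def)
  then show ?thesis by blast
qed

section \<open>Step sizes\<close>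

text \<open>Lets the extremum over the pooled singular values be taken block by block.\<close>

lemma Max_UNION:
  fixes S :: "'i \<Rightarrow> 'a::linorder set"
  assumes "finite I" "I \<noteq> {}" and "\<And>i. i \<in> I \<Longrightarrow> finite (S i)" and "\<And>i. i \<in> I \<Longrightarrow> S i \<noteq> {}"
  shows "Max (\<Union>i\<in>I. S i) = Max ((\<lambda>i. Max (S i)) ` I)"
proof (rule Max_eqI)
  show "Max ((\<lambda>i. Max (S i)) ` I) \<in> (\<Union>i\<in>I. S i)"
  proof -
    have "Max ((\<lambda>i. Max (S i)) ` I) \<in> (\<lambda>i. Max (S i)) ` I"
      using assms by (intro Max_in) auto
    then obtain i where "i \<in> I" "Max ((\<lambda>i. Max (S i)) ` I) = Max (S i)"
      by auto
    then show ?thesis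
      using Max_in[of "S i"] assms by (simp, blast)
  qed
  show "x \<le> Max ((\<lambda>i. Max (S i)) ` I)" if "x \<in> (\<Union>i\<in>I. S i)" for x
    using that assms by (auto simp: Max_ge_iff)
qed (use assms in auto)

lemma Min_UNION:
  fixes S :: "'i \<Rightarrow> 'a::linorder set"
  assumes "finite I" "I \<noteq> {}" and "\<And>i. i \<in> I \<Longrightarrow> finite (S i)" and "\<And>i. i \<in> I \<Longrightarrow> S i \<noteq> {}"
  shows "Min (\<Union>i\<in>I. S i) = Min ((\<lambda>i. Min (S i)) ` I)"
proof (rule Min_eqI)
  show "Min ((\<lambda>i. Min (S i)) ` I) \<in> (\<Union>i\<in>I. S i)"
  proof -
    have "Min ((\<lambda>i. Min (S i)) ` I) \<in> (\<lambda>i. Min (S i)) ` I"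
      using assms by (intro Min_in) auto
    then obtain i where "i \<in> I" "Min ((\<lambda>i. Min (S i)) ` I) = Min (S i)"
      by auto
    then show ?thesis
      using Min_in[of "S i"] assms by (simp, blast)
  qed
  show "Min ((\<lambda>i. Min (S i)) ` I) \<le> x" if "x \<in> (\<Union>i\<in>I. S i)" for x
    using that assms by (auto simp: Min_le_iff)
qed (use assms in auto)

lemma sigma_max_diag_block_mat:
  assumes "As \<noteq> []" and "\<And>A. A \<in> set As \<Longrightarrow> A \<noteq> 0\<^sub>m (dim_row A) (dim_col A)"
  shows "sigma_max (diag_block_mat As) = Max (sigma_max ` set As)"
  unfolding sigma_max_def singular_values_diag_block_mat
  using assms nonzero_singular_value_exists
  by (intro Max_UNION) (auto simp: finite_singular_values)

text \<open>Removing 0 distributes over the union of the blocks' singular values. What remains of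
  each block is nonempty because the block is nonzero, so every inner minimum is attained.\<close>

lemma sigma_min_nz_diag_block_mat:
  assumes "As \<noteq> []" and "\<And>A. A \<in> set As \<Longrightarrow> A \<noteq> 0\<^sub>m (dim_row A) (dim_col A)"
  shows "sigma_min_nz (diag_block_mat As) = Min (sigma_min_nz ` set As)"
proof -
  have "singular_values (diag_block_mat As) - {0} = (\<Union>A\<in>set As. singular_values A - {0})"
    by (auto simp: singular_values_diag_block_mat)
  moreover have "Min (\<Union>A\<in>set As. singular_values A - {0})
      = Min ((\<lambda>A. Min (singular_values A - {0})) ` set As)"
    using assms nonzero_singular_value_exists
    by (intro Min_UNION) (auto simp: finite_singular_values)
  ultimately show ?thesis
    unfolding sigma_min_nz_def by simp
qed

theorem mainTheorem6:
  fixes G :: "'a pair_pre_digraph"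
    and D :: nat
    and C :: "'a \<Rightarrow> real mat"
    and mu beta :: "'a \<Rightarrow> real"
    and vs :: "'a list"
    and smax smin m b :: "nat \<Rightarrow> 'a \<Rightarrow> real"
  assumes undirected: "pair_pseudo_graph G"
    and connected: "Digraph_Component.connected (with_proj G)"
    and diameter: "ereal (real D) = graph_diameter G"
    and nonzero: "\<And>i. i \<in> pverts G \<Longrightarrow> C i \<noteq> 0\<^sub>m (dim_row (C i)) (dim_col (C i))"
    and mu_pos: "\<And>i. i \<in> pverts G \<Longrightarrow> mu i > 0"
    and beta_pos: "\<And>i. i \<in> pverts G \<Longrightarrow> beta i > 0"
    and enum: "distinct vs" "set vs = pverts G"
    and smax_0: "\<And>i. i \<in> pverts G \<Longrightarrow> smax 0 i = sigma_max (C i)"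
    and smin_0: "\<And>i. i \<in> pverts G \<Longrightarrow> smin 0 i = sigma_min_nz (C i)"
    and m_0: "\<And>i. i \<in> pverts G \<Longrightarrow> m 0 i = mu i"
    and b_0: "\<And>i. i \<in> pverts G \<Longrightarrow> b 0 i = beta i"
    and smax_step: "\<And>k i. k < D \<Longrightarrow> i \<in> pverts G \<Longrightarrow>
      smax (k + 1) i = Max (smax k ` (neighbours G i \<union> {i}))"
    and smin_step: "\<And>k i. k < D \<Longrightarrow> i \<in> pverts G \<Longrightarrow>
      smin (k + 1) i = Min (smin k ` (neighbours G i \<union> {i}))"
    and m_step: "\<And>k i. k < D \<Longrightarrow> i \<in> pverts G \<Longrightarrow>
      m (k + 1) i = Min (m k ` (neighbours G i \<union> {i}))"
    and b_step: "\<And>k i. k < D \<Longrightarrow> i \<in> pverts G \<Longrightarrow>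
      b (k + 1) i = Max (b k ` (neighbours G i \<union> {i}))"
  shows "\<forall>i \<in> pverts G.
    sqrt (b D i * m D i) / (smax D i * smin D i) =
    sqrt (Max (beta ` pverts G) * Min (mu ` pverts G)) /
      (sigma_max (diag_block_mat (map C vs)) * sigma_min_nz (diag_block_mat (map C vs)))"
proof
  fix i assume i: "i \<in> pverts G"
  have fin: "pair_fin_digraph G"
    using undirected by (simp add: pair_pseudo_graph_def)
  have ne: "map C vs \<noteq> []"
    using i enum by auto
  have nz: "A \<noteq> 0\<^sub>m (dim_row A) (dim_col A)" if "A \<in> set (map C vs)" for A
    using that nonzero enum by auto
  have "smax D i = Max (smax 0 ` pverts G)"
    by (rule Max_consensus[where f = smax, OF fin diameter smax_step i])
  \<comment> \<open>Only the set of initial values matters, so neither the order of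
    \<open>vs\<close> nor equal blocks at different nodes affect the maximum.\<close>
  also have "smax 0 ` pverts G = sigma_max ` set (map C vs)"
    using smax_0 enum by (auto simp: image_image)
  finally have smax: "smax D i = sigma_max (diag_block_mat (map C vs))"
    by (simp only: sigma_max_diag_block_mat[OF ne nz])
  have "smin D i = Min (smin 0 ` pverts G)"
    by (rule Min_consensus[where f = smin, OF fin diameter smin_step i])
  also have "smin 0 ` pverts G = sigma_min_nz ` set (map C vs)"
    using smin_0 enum by (auto simp: image_image)
  finally have smin: "smin D i = sigma_min_nz (diag_block_mat (map C vs))"
    by (simp only: sigma_min_nz_diag_block_mat[OF ne nz])
  have "m D i = Min (mu ` pverts G)"
    using Min_consensus[where f = m, OF fin diameter m_step i] m_0 by simp
  moreover have "b D i = Max (beta ` pverts G)"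
    using Max_consensus[where f = b, OF fin diameter b_step i] b_0 by simp
  ultimately show "sqrt (b D i * m D i) / (smax D i * smin D i) =
      sqrt (Max (beta ` pverts G) * Min (mu ` pverts G)) /
        (sigma_max (diag_block_mat (map C vs)) * sigma_min_nz (diag_block_mat (map C vs)))"
    by (simp add: smax smin)
qed

end
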